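(* Let $0<p<1$ and let $s<r\le1$ be real numbers. For every sequence $(a_n)_{n\ge1}$ of non-negative reals, $$\sum_{n=1}^{\infty}\left(n^{s-1}\sum_{k=n}^{\infty}\frac{a_k}{\sum_{i=1}^{k}i^{s-1}}\right)^p\le\sum_{n=1}^{\infty}\left(n^{r-1}\sum_{k=n}^{\infty}\frac{a_k}{\sum_{i=1}^{k}i^{r-1}}\right)^p .$$ The constant is best possible, i.e. for each such $p,r,s$ the constant $1$ multiplying the right-hand side cannot be replaced by any smaller constant for which the inequality holds for all non-negative sequences $(a_n)$.
   Context: All sums of non-negative terms are understood as elements of $[0,\infty]$, with $\infty^p=\infty$. *)

theory Defs
  imports "HOL-Analysis.Analysis"
begin

(* Real powers on [0,\<infinity>] with \<infinity> ^ p = \<infinity>; only meaningful for p > 0 (0 ^ p = 0 then holds,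
   since 0 powr p = 0). *)
definition ennreal_powr :: "ennreal \<Rightarrow> real \<Rightarrow> ennreal" where
  "ennreal_powr x p = (if x = \<infinity> then \<infinity> else ennreal (enn2real x powr p))"

(* \<Sum>_{n \<ge> 1} (n^(s-1) \<Sum>_{k \<ge> n} a_k / \<Sum>_{i=1}^k i^(s-1))^p as an element of [0,\<infinity>].
   suminf starts at 0, so the outer index is n = Suc m and the inner one k = Suc m + j;
   the value a 0 is never used. *)
definition weighted_tail_sum :: "real \<Rightarrow> real \<Rightarrow> (nat \<Rightarrow> real) \<Rightarrow> ennreal" where
  "weighted_tail_sum p s a =
     (\<Sum>m. ennreal_powr
        (ennreal (real (Suc m) powr (s - 1)) *
         (\<Sum>j. ennreal (a (Suc m + j) / (\<Sum>i = 1..Suc m + j. real i powr (s - 1))))) p)"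

end

theory Submission
  imports Defs
begin

text \<open>Column k of either operator is a probability vector on the indices up to k, so truncating the
  sequence leaves two finite vectors with the same total. Since i^(s-1) / i^(r-1) decreases, the
  vector built with s has the larger initial sums; since r \<le> 1, the vector built with r decreases.
  Hence the former majorises the latter, and Karamata's inequality for the concave function t^p gives
  the claim for truncations. Sequences in general follow by monotone limits, and the first unit
  vector gives equality.\<close>

section \<open>Concavity of powers and Karamata's inequality\<close>

text \<open>Weighted AM-GM (Young) for \<open>x\<close> and \<open>y\<close>, multiplied by
  \<open>y powr (p - 1)\<close>, yields the tangent line of the concave power at \<open>y\<close>
  without any calculus.\<close>

lemma powr_tangent_bound:
  fixes x y p :: real
  assumes "0 \<le> x" "0 < y" "0 \<le> p" "p \<le> 1"
  shows "x powr p - y powr p \<le> p * y powr (p - 1) * (x - y)"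
proof -
  have 1: "x powr p * y powr (1 - p) \<le> p * x + (1 - p) * y"
    using Youngs_inequality_0[of p "1 - p" x y] assms by (cases "x = 0") auto
  have 2: "y powr (1 - p) * y powr (p - 1) = 1" "y * y powr (p - 1) = y powr p"
    using assms by (simp_all add: powr_add[symmetric] powr_mult_base)
  have "x powr p = x powr p * y powr (1 - p) * y powr (p - 1)"
    using 2 by (simp add: mult.assoc)
  also have "\<dots> \<le> (p * x + (1 - p) * y) * y powr (p - 1)"
    using 1 by (intro mult_right_mono) auto
  also have "\<dots> = p * y powr (p - 1) * (x - y) + y * y powr (p - 1)"
    by (simp add: algebra_simps)
  finally show ?thesis using 2 by simp
qed

text \<open>Abel summation as an induction: replacing \<open>c N\<close> by the larger
  \<open>c (Suc N)\<close> in front of a non-negative partial sum can only increase the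
  bound.\<close>

lemma sum_mult_mono_le:
  fixes c d :: "nat \<Rightarrow> real"
  assumes "\<And>n. n < N \<Longrightarrow> c n \<le> c (Suc n)"
    and "\<And>n. n \<le> N \<Longrightarrow> 0 \<le> (\<Sum>i\<le>n. d i)"
  shows "(\<Sum>n\<le>N. c n * d n) \<le> c N * (\<Sum>n\<le>N. d n)"
  using assms
proof (induction N)
  case (Suc N)
  have "(\<Sum>n\<le>N. c n * d n) \<le> c N * (\<Sum>n\<le>N. d n)"
    using Suc by simp
  also have "\<dots> \<le> c (Suc N) * (\<Sum>n\<le>N. d n)"
    using Suc.prems by (intro mult_right_mono) auto
  finally show ?case by (simp add: algebra_simps)
qed simp

text \<open>Tangents are taken at \<open>y n\<close>. Their slopes grow as \<open>y\<close>
  decreases, and the partial sums of \<open>x - y\<close> are non-negative, so Abel summation bounds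
  the difference by the last slope times the total of \<open>x - y\<close>, which is 0. Ordering
  \<open>y\<close> alone suffices.\<close>

lemma karamata_powr:
  fixes x y :: "nat \<Rightarrow> real" and p :: real
  assumes p: "0 \<le> p" "p \<le> 1"
    and x: "\<And>n. n \<le> N \<Longrightarrow> 0 \<le> x n" and y: "\<And>n. n \<le> N \<Longrightarrow> 0 < y n"
    and decr: "\<And>n. n < N \<Longrightarrow> y (Suc n) \<le> y n"
    and le: "\<And>n. n \<le> N \<Longrightarrow> (\<Sum>i\<le>n. y i) \<le> (\<Sum>i\<le>n. x i)"
    and eq: "(\<Sum>i\<le>N. y i) = (\<Sum>i\<le>N. x i)"
  shows "(\<Sum>n\<le>N. x n powr p) \<le> (\<Sum>n\<le>N. y n powr p)"
proof -
  have "(\<Sum>n\<le>N. x n powr p) - (\<Sum>n\<le>N. y n powr p)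
      \<le> (\<Sum>n\<le>N. p * y n powr (p - 1) * (x n - y n))"
    unfolding sum_subtractf[symmetric] using p x y
    by (intro sum_mono powr_tangent_bound) auto
  also have "\<dots> \<le> p * y N powr (p - 1) * (\<Sum>n\<le>N. x n - y n)"
  proof (rule sum_mult_mono_le)
    fix n assume "n < N"
    then show "p * y n powr (p - 1) \<le> p * y (Suc n) powr (p - 1)"
      using p y[of "Suc n"] decr by (intro mult_left_mono powr_mono2') auto
  qed (use le in \<open>simp add: sum_subtractf\<close>)
  finally show ?thesis using eq by (simp add: sum_subtractf)
qed

section \<open>Majorisation for truncated sequences\<close>

text \<open>Indices start at 0 here: \<open>w n\<close> and \<open>b n\<close> stand for the terms numbered \<open>n + 1\<close> of the
  informal statement.\<close>

definition tail_trunc :: "(nat \<Rightarrow> real) \<Rightarrow> (nat \<Rightarrow> real) \<Rightarrow> nat \<Rightarrow> nat \<Rightarrow> real" where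
  "tail_trunc w b N n = w n * (\<Sum>k=n..<N. b k / (\<Sum>i\<le>k. w i))"

text \<open>After exchanging the sums, the factor of \<open>b k\<close> is the mass that column
  \<open>k\<close> places on the first \<open>m\<close> indices. Initial sums can thus be compared
  column by column.\<close>

lemma sum_tail_trunc:
  "(\<Sum>n<m. tail_trunc w b N n) = (\<Sum>k<N. b k * ((\<Sum>n<min m (Suc k). w n) / (\<Sum>i\<le>k. w i)))"
proof -
  have "(\<Sum>n<m. tail_trunc w b N n)
      = (\<Sum>n<m. \<Sum>k<N. if n \<le> k then w n * (b k / (\<Sum>i\<le>k. w i)) else 0)"
    unfolding tail_trunc_def sum_distrib_left
    by (intro sum.cong refl sum.mono_neutral_cong_left) auto
  also have "\<dots> = (\<Sum>k<N. \<Sum>n<m. if n \<le> k then w n * (b k / (\<Sum>i\<le>k. w i)) else 0)"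
    by (rule sum.swap)
  also have "\<dots> = (\<Sum>k<N. \<Sum>n<min m (Suc k). w n * (b k / (\<Sum>i\<le>k. w i)))"
    by (intro sum.cong refl sum.mono_neutral_cong_right) auto
  also have "\<dots> = (\<Sum>k<N. b k * ((\<Sum>n<min m (Suc k). w n) / (\<Sum>i\<le>k. w i)))"
    by (simp add: sum_distrib_left sum_divide_distrib mult.commute)
  finally show ?thesis .
qed

text \<open>Cross-multiplied, both sides share the product of the two heads. What remains is head of
  \<open>v\<close> times tail of \<open>w\<close> against head of \<open>w\<close> times tail of
  \<open>v\<close>, and there \<open>ratio\<close> applies termwise because head indices precede
  tail indices.\<close>

lemma initial_fraction_mono:
  fixes w v :: "nat \<Rightarrow> real"
  assumes w: "\<And>n. 0 < w n" and v: "\<And>n. 0 < v n"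
    and ratio: "\<And>m n. m \<le> n \<Longrightarrow> v m * w n \<le> w m * v n"
    and "m \<le> Suc k"
  shows "(\<Sum>n<m. v n) / (\<Sum>n\<le>k. v n) \<le> (\<Sum>n<m. w n) / (\<Sum>n\<le>k. w n)"
proof -
  have split: "(\<Sum>n\<le>k. u n) = (\<Sum>n<m. u n) + (\<Sum>n=m..k. u n)" for u :: "nat \<Rightarrow> real"
  proof -
    have "{..k} = {..<m} \<union> {m..k}" using assms(4) by auto
    moreover have "{..<m} \<inter> {m..k} = {}" by auto
    ultimately show ?thesis by (simp add: sum.union_disjoint)
  qed
  have pos: "0 < (\<Sum>n\<le>k. w n)" "0 < (\<Sum>n\<le>k. v n)"
    using w v by (auto intro!: sum_pos)
  have "(\<Sum>n<m. v n) * (\<Sum>n=m..k. w n) \<le> (\<Sum>n<m. w n) * (\<Sum>n=m..k. v n)"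
    unfolding sum_product using ratio by (intro sum_mono) auto
  then have "(\<Sum>n<m. v n) * (\<Sum>n\<le>k. w n) \<le> (\<Sum>n<m. w n) * (\<Sum>n\<le>k. v n)"
    unfolding split by (simp add: algebra_simps)
  then show ?thesis using pos by (simp add: divide_simps)
qed

text \<open>The induction only strips a vanishing last entry \<open>b N\<close>; otherwise Karamata
  applies directly.\<close>

lemma sum_powr_tail_trunc_le:
  fixes w v b :: "nat \<Rightarrow> real" and p :: real
  assumes p: "0 \<le> p" "p \<le> 1"
    and w: "\<And>n. 0 < w n" and v: "\<And>n. 0 < v n"
    and ratio: "\<And>m n. m \<le> n \<Longrightarrow> v m * w n \<le> w m * v n"
    and v_decr: "\<And>n. v (Suc n) \<le> v n" and b: "\<And>n. 0 \<le> b n"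
  shows "(\<Sum>n<N. tail_trunc w b N n powr p) \<le> (\<Sum>n<N. tail_trunc v b N n powr p)"
proof (induction N)
  case (Suc N)
  \<comment> \<open>If \<open>b N > 0\<close>, all entries of the vector built with \<open>v\<close> are positive, as the tangent bound needs.\<close>
  show ?case
  proof (cases "b N = 0")
    case True
    then have "tail_trunc u b (Suc N) n = tail_trunc u b N n" for u n
      by (simp add: tail_trunc_def)
    moreover have "tail_trunc u b N N = 0" for u
      by (simp add: tail_trunc_def)
    ultimately show ?thesis using Suc by simp
  next
    case False
    have W: "0 < (\<Sum>i\<le>k. w i)" and V: "0 < (\<Sum>i\<le>k. v i)" for k
      using w v by (auto intro!: sum_pos)
    have terms: "0 \<le> b k / (\<Sum>i\<le>k. w i)" "0 \<le> b k / (\<Sum>i\<le>k. v i)" for k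
      using W V b by (simp_all add: less_imp_le)
    show ?thesis unfolding lessThan_Suc_atMost
    proof (rule karamata_powr[OF p])
      fix n
      show "0 \<le> tail_trunc w b (Suc N) n"
        unfolding tail_trunc_def using terms w
        by (intro mult_nonneg_nonneg sum_nonneg) (auto simp: less_imp_le)
      show "0 < tail_trunc v b (Suc N) n" if "n \<le> N"
        unfolding tail_trunc_def
      proof (rule mult_pos_pos[OF v])
        show "0 < (\<Sum>k=n..<Suc N. b k / (\<Sum>i\<le>k. v i))"
          using that False b[of N] V[of N] terms
          by (intro sum_pos2[of _ N]) (auto simp: less_le)
      qed
      show "tail_trunc v b (Suc N) (Suc n) \<le> tail_trunc v b (Suc N) n"
        unfolding tail_trunc_def using terms v v_decr
        by (intro mult_mono sum_mono2 sum_nonneg) (auto simp: less_imp_le)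
      show "(\<Sum>i\<le>n. tail_trunc v b (Suc N) i) \<le> (\<Sum>i\<le>n. tail_trunc w b (Suc N) i)"
        unfolding lessThan_Suc_atMost[symmetric]
        unfolding sum_tail_trunc
        by (intro sum_mono mult_left_mono initial_fraction_mono w v ratio b) auto
      \<comment> \<open>At full length each column lies entirely in range, so both fractions are 1
        and both totals equal the sum of \<open>b\<close>.\<close>
      show "(\<Sum>i\<le>N. tail_trunc v b (Suc N) i) = (\<Sum>i\<le>N. tail_trunc w b (Suc N) i)"
        unfolding lessThan_Suc_atMost[symmetric]
        unfolding sum_tail_trunc
      proof (intro sum.cong refl)
        fix k assume "k \<in> {..<Suc N}"
        then have "min (Suc N) (Suc k) = Suc k" by simp
        then show "b k * ((\<Sum>n<min (Suc N) (Suc k). v n) / (\<Sum>i\<le>k. v i))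
            = b k * ((\<Sum>n<min (Suc N) (Suc k). w n) / (\<Sum>i\<le>k. w i))"
          using W[of k] V[of k] by (simp add: lessThan_Suc_atMost)
      qed
    qed
  qed
qed simp

section \<open>Extended powers and passage to the limit\<close>

lemma ennreal_powr_ennreal: "0 \<le> x \<Longrightarrow> ennreal_powr (ennreal x) p = ennreal (x powr p)"
  by (simp add: ennreal_powr_def)

lemma ennreal_powr_mono:
  assumes "0 \<le> p" "x \<le> y"
  shows "ennreal_powr x p \<le> ennreal_powr y p"
proof (cases y)
  case (real u)
  then show ?thesis using assms
    by (cases x) (auto simp: ennreal_powr_ennreal powr_mono2 ennreal_leI top_unique)
qed (simp add: ennreal_powr_def)

lemma tendsto_ennreal_powr:
  assumes p: "0 < p" and f: "\<And>n. 0 \<le> f n" and lim: "(\<lambda>n. ennreal (f n)) \<longlonglongrightarrow> L"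
  shows "(\<lambda>n. ennreal (f n powr p)) \<longlonglongrightarrow> ennreal_powr L p"
proof (cases L)
  case (real u)
  then have "f \<longlonglongrightarrow> u" using lim f by simp
  then have "(\<lambda>n. f n powr p) \<longlonglongrightarrow> u powr p"
    using p f by (intro tendsto_powr') auto
  then show ?thesis using real by (simp add: ennreal_powr_ennreal)
next
  case top
  then have "filterlim f at_top sequentially"
    using lim by (simp add: ennreal_tendsto_top_eq_at_top)
  have "filterlim (\<lambda>n. f n powr p) at_top sequentially"
    unfolding filterlim_at_top
  proof
    fix Z :: real
    \<comment> \<open>The maximum with 1 keeps the base positive, so that the power \<open>p\<close>
      undoes the power \<open>1 / p\<close> and returns a number at least \<open>Z\<close>.\<close>
    have "\<forall>\<^sub>F n in sequentially. max Z 1 powr (1 / p) \<le> f n"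
      using \<open>filterlim f at_top sequentially\<close> by (simp add: filterlim_at_top)
    then show "\<forall>\<^sub>F n in sequentially. Z \<le> f n powr p"
    proof eventually_elim
      case (elim n)
      then have "(max Z 1 powr (1 / p)) powr p \<le> f n powr p"
        using p by (intro powr_mono2) auto
      then show ?case using p by (simp add: powr_powr)
    qed
  qed
  then show ?thesis using top
    by (simp add: ennreal_tendsto_top_eq_at_top ennreal_powr_def)
qed

definition tail_full :: "(nat \<Rightarrow> real) \<Rightarrow> (nat \<Rightarrow> real) \<Rightarrow> nat \<Rightarrow> ennreal" where
  "tail_full w b n = ennreal (w n) * (\<Sum>j. ennreal (b (n + j) / (\<Sum>i\<le>n + j. w i)))"

text \<open>Length \<open>N + n\<close> leaves exactly \<open>N\<close> terms from index
  \<open>n\<close> on, which matches a partial sum of the series in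
  \<open>tail_full\<close>.\<close>

lemma ennreal_tail_trunc:
  assumes w: "\<And>n. 0 < w n" and b: "\<And>n. 0 \<le> b n"
  shows "ennreal (tail_trunc w b (N + n) n)
    = ennreal (w n) * (\<Sum>j<N. ennreal (b (n + j) / (\<Sum>i\<le>n + j. w i)))"
proof -
  have terms: "0 \<le> b k / (\<Sum>i\<le>k. w i)" for k
    using w b by (intro divide_nonneg_nonneg sum_nonneg) (auto simp: less_imp_le)
  have "(\<Sum>k=n..<N+n. b k / (\<Sum>i\<le>k. w i)) = (\<Sum>j<N. b (n + j) / (\<Sum>i\<le>n + j. w i))"
    using sum.shift_bounds_nat_ivl[of "\<lambda>k. b k / (\<Sum>i\<le>k. w i)" 0 n N]
    by (simp add: add.commute lessThan_atLeast0)
  then show ?thesis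
    unfolding tail_trunc_def using terms w
    by (simp add: ennreal_mult sum_nonneg less_imp_le sum_ennreal)
qed

lemma tail_trunc_nonneg:
  assumes "\<And>n. 0 < w n" "\<And>n. 0 \<le> b n"
  shows "0 \<le> tail_trunc w b N n"
  unfolding tail_trunc_def using assms
  by (intro mult_nonneg_nonneg sum_nonneg divide_nonneg_nonneg) (auto simp: less_imp_le)

lemma tail_trunc_LIMSEQ:
  assumes "\<And>n. 0 < w n" "\<And>n. 0 \<le> b n"
  shows "(\<lambda>N. ennreal (tail_trunc w b N n)) \<longlonglongrightarrow> tail_full w b n"
proof (rule LIMSEQ_offset)
  show "(\<lambda>N. ennreal (tail_trunc w b (N + n) n)) \<longlonglongrightarrow> tail_full w b n"
    unfolding ennreal_tail_trunc[OF assms] tail_full_def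
    by (intro ennreal_tendsto_cmult summable_LIMSEQ) auto
qed

lemma tail_trunc_le_tail_full:
  assumes "\<And>n. 0 < w n" "\<And>n. 0 \<le> b n" "n \<le> N"
  shows "ennreal (tail_trunc w b N n) \<le> tail_full w b n"
proof -
  have "N = N - n + n" using assms(3) by simp
  then show ?thesis
    unfolding tail_full_def
    using ennreal_tail_trunc[where w=w and b=b and n=n and N="N - n", OF assms(1,2)]
    by (simp add: mult_left_mono sum_le_suminf)
qed

theorem tail_full_powr_mono:
  fixes w v b :: "nat \<Rightarrow> real" and p :: real
  assumes p: "0 < p" "p \<le> 1"
    and w: "\<And>n. 0 < w n" and v: "\<And>n. 0 < v n"
    and ratio: "\<And>m n. m \<le> n \<Longrightarrow> v m * w n \<le> w m * v n"
    and v_decr: "\<And>n. v (Suc n) \<le> v n" and b: "\<And>n. 0 \<le> b n"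
  shows "(\<Sum>n. ennreal_powr (tail_full w b n) p) \<le> (\<Sum>n. ennreal_powr (tail_full v b n) p)"
    (is "_ \<le> ?R")
proof (rule suminf_le_const)
  fix M
  show "(\<Sum>n<M. ennreal_powr (tail_full w b n) p) \<le> ?R"
  proof (rule LIMSEQ_le_const2)
    show "(\<lambda>N. \<Sum>n<M. ennreal (tail_trunc w b N n powr p))
        \<longlonglongrightarrow> (\<Sum>n<M. ennreal_powr (tail_full w b n) p)"
      by (intro tendsto_sum tendsto_ennreal_powr[OF p(1)] tail_trunc_LIMSEQ tail_trunc_nonneg w b)
    \<comment> \<open>The outer cutoff \<open>M\<close> stays fixed while \<open>N\<close> tends to
      infinity. For \<open>N\<close> at least \<open>M\<close>, the outer sum is enlarged to length
      \<open>N\<close>, where the finite inequality applies.\<close>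
    have "(\<Sum>n<M. ennreal (tail_trunc w b N n powr p)) \<le> ?R" if "M \<le> N" for N
    proof -
      have "(\<Sum>n<M. ennreal (tail_trunc w b N n powr p))
          \<le> (\<Sum>n<N. ennreal (tail_trunc w b N n powr p))"
        using that by (intro sum_mono2) auto
      also have "\<dots> \<le> (\<Sum>n<N. ennreal (tail_trunc v b N n powr p))"
        using sum_powr_tail_trunc_le[where w=w and v=v and b=b and p=p and N=N]
          p w v ratio v_decr b
        by (simp add: sum_ennreal ennreal_leI)
      also have "\<dots> \<le> (\<Sum>n<N. ennreal_powr (tail_full v b n) p)"
      proof (rule sum_mono)
        fix n assume "n \<in> {..<N}"
        then show "ennreal (tail_trunc v b N n powr p) \<le> ennreal_powr (tail_full v b n) p"
          using ennreal_powr_mono[OF less_imp_le[OF p(1)] tail_trunc_le_tail_full[OF v b]]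
          by (simp add: ennreal_powr_ennreal tail_trunc_nonneg v b)
      qed
      also have "\<dots> \<le> ?R" by (intro sum_le_suminf) auto
      finally show ?thesis .
    qed
    then show "\<exists>N0. \<forall>N\<ge>N0. (\<Sum>n<M. ennreal (tail_trunc w b N n powr p)) \<le> ?R" by blast
  qed
qed auto

section \<open>Power weights and sharpness\<close>

lemma weighted_tail_sum_eq:
  "weighted_tail_sum p s a =
    (\<Sum>n. ennreal_powr (tail_full (\<lambda>i. real (Suc i) powr (s - 1)) (\<lambda>k. a (Suc k)) n) p)"
proof -
  have "(\<Sum>i = 1..Suc k. real i powr (s - 1)) = (\<Sum>i\<le>k. real (Suc i) powr (s - 1))" for k
    using sum.atLeast_Suc_atMost_Suc_shift[of "\<lambda>i. real i powr (s - 1)" 0 k]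
    by (simp add: atMost_atLeast0)
  then show ?thesis
    unfolding weighted_tail_sum_def tail_full_def add_Suc by (simp only:)
qed

text \<open>Only the first row and first column survive, with weight and denominator both
  \<open>1 powr (s - 1)\<close>, so the value is the same for every \<open>s\<close>.\<close>

lemma weighted_tail_sum_unit:
  assumes "0 < p"
  shows "weighted_tail_sum p s (\<lambda>n. if n = 1 then 1 else 0) = 1"
proof -
  define t where "t = (\<lambda>m j. ennreal ((if Suc m + j = 1 then 1 else 0)
    / (\<Sum>i = 1..Suc m + j. real i powr (s - 1))))"
  have "(\<Sum>j. t m j) = (\<Sum>j\<in>{0}. t m j)" for m
    by (rule suminf_finite) (simp_all add: t_def)
  then have t: "(\<Sum>j. t m j) = (if m = 0 then 1 else 0)" for m
    by (simp add: t_def)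
  have "weighted_tail_sum p s (\<lambda>n. if n = 1 then 1 else 0)
      = (\<Sum>m. ennreal_powr (ennreal (real (Suc m) powr (s - 1)) * (\<Sum>j. t m j)) p)"
    unfolding weighted_tail_sum_def t_def ..
  also have "\<dots> = (\<Sum>m\<in>{0}. ennreal_powr (ennreal (real (Suc m) powr (s - 1)) * (\<Sum>j. t m j)) p)"
    unfolding t by (rule suminf_finite) (simp_all add: ennreal_powr_def)
  also have "\<dots> = 1"
    unfolding t by (simp add: ennreal_powr_def)
  finally show ?thesis .
qed

theorem theorem4p5:
  fixes p r s :: real
  assumes "0 < p" and "p < 1" and "s < r" and "r \<le> 1"
  shows "(\<forall>a :: nat \<Rightarrow> real. (\<forall>n\<ge>1. 0 \<le> a n) \<longrightarrow>
            weighted_tail_sum p s a \<le> weighted_tail_sum p r a) \<and>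
         (\<forall>C :: ennreal. C < 1 \<longrightarrow>
            \<not> (\<forall>a :: nat \<Rightarrow> real. (\<forall>n\<ge>1. 0 \<le> a n) \<longrightarrow>
                 weighted_tail_sum p s a \<le> C * weighted_tail_sum p r a))"
proof (intro conjI allI impI notI)
  fix a :: "nat \<Rightarrow> real"
  assume a: "\<forall>n\<ge>1. 0 \<le> a n"
  show "weighted_tail_sum p s a \<le> weighted_tail_sum p r a"
    unfolding weighted_tail_sum_eq
  proof (rule tail_full_powr_mono)
    fix m n :: nat
    assume mn: "m \<le> n"
    \<comment> \<open>With the common factors removed, the ratio condition says that
      \<open>real (Suc k) powr (r - s)\<close> increases in \<open>k\<close>, which is where
      \<open>s < r\<close> enters.\<close>
    have split: "real (Suc k) powr (r - 1) = real (Suc k) powr (s - 1) * real (Suc k) powr (r - s)" for k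
      by (simp add: powr_add[symmetric] del: of_nat_Suc)
    have "real (Suc m) powr (r - s) \<le> real (Suc n) powr (r - s)"
      using mn assms by (intro powr_mono2) auto
    then show "real (Suc m) powr (r - 1) * real (Suc n) powr (s - 1)
        \<le> real (Suc m) powr (s - 1) * real (Suc n) powr (r - 1)"
      unfolding split by (simp add: mult.assoc mult.left_commute mult_left_mono del: of_nat_Suc)
  next
    fix n
    show "real (Suc (Suc n)) powr (r - 1) \<le> real (Suc n) powr (r - 1)"
      using assms by (intro powr_mono2') auto
  qed (use assms a in auto)
next
  fix C :: ennreal
  assume C: "C < 1"
    and bound: "\<forall>a :: nat \<Rightarrow> real. (\<forall>n\<ge>1. 0 \<le> a n) \<longrightarrow>
      weighted_tail_sum p s a \<le> C * weighted_tail_sum p r a"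
  \<comment> \<open>On the first unit vector both sums equal 1, so the assumed bound reads
    \<open>1 \<le> C\<close>.\<close>
  have "1 \<le> C"
    using bound[rule_format, of "\<lambda>n. if n = 1 then 1 else 0"]
    by (simp add: weighted_tail_sum_unit[OF assms(1), unfolded One_nat_def])
  with C show False by simp
qed

end
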